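(* Let $f:\mathbb{R}^n\to\mathbb{R}$ and $G:\mathbb{R}^n\to S^p$ be twice continuously differentiable, let $\bar x$ be a stationary point of the problem $\min f(x)$ s.t. $G(x)\in S^p_+$, and let $\bar y\in\Lambda(\bar x)$ be an associated Lagrange multiplier. If the second order sufficient condition with respect to $\bar y$, $$\langle d,\nabla^2_{xx}L(\bar x,\bar y)d\rangle-\sigma\big(\bar y,T^2_{S^p_+}(G(\bar x),G'(\bar x)d)\big)>0\qquad\forall d\in C(\bar x)\setminus\{0\},$$ holds, then the multiplier $\bar y$ is noncritical.
   Context: $S^p$ is the space of real symmetric $p\times p$ matrices with the trace inner product; $S^p_+$ is the cone of positive semidefinite matrices. $L(x,y)=f(x)+\langle y,G(x)\rangle$ for $(x,y)\in\mathbb{R}^n\times S^p$. $G'(\bar x):\mathbb{R}^n\to S^p$ is the derivative and $G'(\bar x)^*$ its adjoint. $N(x;\Omega)$ is the normal cone of convex analysis to the convex set $\Omega$ at $x\in\Omega$, and empty if $x\notin\Omega$. For feasible $\bar x$, $\Lambda(\bar x)=\{y\in S^p:\nabla_xL(\bar x,y)=0,\ y\in N(G(\bar x);S^p_+)\}$; a feasible $\bar x$ is stationary if $\Lambda(\bar x)\neq\emptyset$. For a set $\Omega$ in a finite-dimensional Hilbert space and $z\in\Omega$, the tangent cone is $T(z;\Omega)=\limsup_{t\downarrow0}(\Omega-z)/t$ (outer limit). The critical cone is $C(\bar x)=\{d\in\mathbb{R}^n:G'(\bar x)d\in T(G(\bar x);S^p_+),\ f'(\bar x)d\le0\}$. $T^2_{S^p_+}(A,H)=\{W\in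 S^p:\operatorname{dist}(A+tH+\tfrac12t^2W,S^p_+)=o(t^2),\ t\downarrow0\}$ is the second order tangent set to $S^p_+$ at $A$ in the direction $H$, and $\sigma(y,\mathcal T)=\sup_{W\in\mathcal T}\langle y,W\rangle$ is the support function of $\mathcal T$. For a set-valued mapping $F$ with $(u,v)\in\operatorname{gph}F$, the graphical derivative is $DF(u,v)(h)=\{k:(h,k)\in T((u,v);\operatorname{gph}F)\}$. Let $\mathcal N:S^p\rightrightarrows S^p$, $\mathcal N(X)=N(X;S^p_+)$. A multiplier $\bar y\in\Lambda(\bar x)$ is critical if there is $\xi\in\mathbb{R}^n$, $\xi\neq0$, with $0\in\nabla^2_{xx}L(\bar x,\bar y)\xi+G'(\bar x)^*\,D\mathcal N(G(\bar x),\bar y)(G'(\bar x)\xi)$; it is noncritical otherwise. *)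

theory Defs
  imports "HOL-Analysis.Analysis" "HOL-Library.Landau_Symbols"
begin

section \<open>Symmetric matrices\<close>

text \<open>
  The space \<open>S\<^sup>p\<close> is represented as a linear subspace of the type of all square matrices.
  The inner product of that type is the sum of the products of the entries, which is the trace
  inner product on \<open>S\<^sup>p\<close>, see the lemma \<open>sym_mats_inner_eq_trace\<close> below.
\<close>

definition sym_mats :: "(real ^ 'p ^ 'p) set"
  where "sym_mats = {A. transpose A = A}"

definition psd_cone :: "(real ^ 'p ^ 'p) set"
  where "psd_cone = {A \<in> sym_mats. \<forall>v. 0 \<le> v \<bullet> (A *v v)}"

lemma sym_mats_inner_eq_trace:
  fixes A B :: "real ^ 'p ^ 'p"
  assumes "A \<in> sym_mats"
  shows "A \<bullet> B = trace (A ** B)"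
proof -
  have "A \<bullet> B = (\<Sum>i\<in>UNIV. \<Sum>j\<in>UNIV. A $ i $ j * B $ i $ j)"
    by (simp add: inner_vec_def)
  also have "\<dots> = (\<Sum>j\<in>UNIV. \<Sum>i\<in>UNIV. A $ i $ j * B $ i $ j)"
    by (rule sum.swap)
  also have "\<dots> = (\<Sum>j\<in>UNIV. \<Sum>i\<in>UNIV. A $ j $ i * B $ i $ j)"
  proof -
    have "A $ i $ j = A $ j $ i" for i j
      using assms by (metis (mono_tags, lifting) mem_Collect_eq sym_mats_def transpose_def vec_lambda_beta)
    then show ?thesis by simp
  qed
  also have "\<dots> = trace (A ** B)"
    by (simp add: trace_def matrix_matrix_mult_def)
  finally show ?thesis .
qed


section \<open>Derivatives\<close>

definition twice_cont_diff :: "('a::euclidean_space \<Rightarrow> 'b::euclidean_space) \<Rightarrow> bool"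
  where "twice_cont_diff f \<longleftrightarrow>
    (\<exists>(f' :: 'a \<Rightarrow> 'a \<Rightarrow>\<^sub>L 'b) (f'' :: 'a \<Rightarrow> 'a \<Rightarrow>\<^sub>L 'a \<Rightarrow>\<^sub>L 'b).
      (\<forall>x. (f has_derivative blinfun_apply (f' x)) (at x)) \<and>
      (\<forall>x. (f' has_derivative blinfun_apply (f'' x)) (at x)) \<and>
      continuous_on UNIV f'')"

definition gradient :: "('a::euclidean_space \<Rightarrow> real) \<Rightarrow> 'a \<Rightarrow> 'a"
  where "gradient f x = (THE g. GDERIV f x :> g)"

definition hessian :: "('a::euclidean_space \<Rightarrow> real) \<Rightarrow> 'a \<Rightarrow> 'a \<Rightarrow> 'a"
  where "hessian f x = frechet_derivative (gradient f) (at x)"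


section \<open>Variational analysis\<close>

definition outer_limit :: "(real \<Rightarrow> 'a::euclidean_space set) \<Rightarrow> 'a set"
  where "outer_limit C = {w. \<exists>(t :: nat \<Rightarrow> real) (u :: nat \<Rightarrow> 'a).
    filterlim t (at_right 0) sequentially \<and> u \<longlonglongrightarrow> w \<and> (\<forall>k. u k \<in> C (t k))}"

definition tangent_cone :: "'a::euclidean_space set \<Rightarrow> 'a \<Rightarrow> 'a set"
  where "tangent_cone \<Omega> z = outer_limit (\<lambda>t. (\<lambda>w. (w - z) /\<^sub>R t) ` \<Omega>)"

definition normal_cone :: "'a::euclidean_space set \<Rightarrow> 'a \<Rightarrow> 'a set"
  where "normal_cone \<Omega> x = (if x \<in> \<Omega> then {v. \<forall>z\<in>\<Omega>. v \<bullet> (z - x) \<le> 0} else {})"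

definition graph_of :: "('a \<Rightarrow> 'b set) \<Rightarrow> ('a \<times> 'b) set"
  where "graph_of F = {(u, v). v \<in> F u}"

definition graphical_derivative ::
    "('a::euclidean_space \<Rightarrow> 'b::euclidean_space set) \<Rightarrow> 'a \<Rightarrow> 'b \<Rightarrow> 'a \<Rightarrow> 'b set"
  where "graphical_derivative F u v h = {k. (h, k) \<in> tangent_cone (graph_of F) (u, v)}"

text \<open>
  The support function is extended-real-valued: it is \<open>-\<infinity>\<close> on the empty set and may be \<open>\<infinity>\<close>.
\<close>

definition support_fun :: "'a::euclidean_space \<Rightarrow> 'a set \<Rightarrow> ereal"
  where "support_fun y T = (SUP W\<in>T. ereal (y \<bullet> W))"

text \<open>
  The normal cone to \<open>S\<^sup>p\<^sub>+\<close> is taken in \<open>S\<^sup>p\<close>. The intersection is needed, since the normal cone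
  in the space of all matrices also contains every skew-symmetric matrix. No such intersection
  is needed for tangent cones: \<open>S\<^sup>p\<close> is closed in the space of all matrices.
\<close>

definition psd_normal :: "real ^ 'p ^ 'p \<Rightarrow> (real ^ 'p ^ 'p) set"
  where "psd_normal X = normal_cone psd_cone X \<inter> sym_mats"

definition psd_second_tangent :: "real ^ 'p ^ 'p \<Rightarrow> real ^ 'p ^ 'p \<Rightarrow> (real ^ 'p ^ 'p) set"
  where "psd_second_tangent A H = {W \<in> sym_mats.
    (\<lambda>t. infdist (A + t *\<^sub>R H + (t\<^sup>2 / 2) *\<^sub>R W) psd_cone) \<in> o[at_right 0](\<lambda>t. t\<^sup>2)}"


section \<open>The semidefinite program\<close>

definition lagrangian ::
    "(real ^ 'n \<Rightarrow> real) \<Rightarrow> (real ^ 'n \<Rightarrow> real ^ 'p ^ 'p) \<Rightarrow> real ^ 'n \<Rightarrow> real ^ 'p ^ 'p \<Rightarrow> real"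
  where "lagrangian f G x y = f x + y \<bullet> G x"

definition multipliers ::
    "(real ^ 'n \<Rightarrow> real) \<Rightarrow> (real ^ 'n \<Rightarrow> real ^ 'p ^ 'p) \<Rightarrow> real ^ 'n \<Rightarrow> (real ^ 'p ^ 'p) set"
  where "multipliers f G x =
    {y \<in> sym_mats. gradient (\<lambda>x. lagrangian f G x y) x = 0 \<and> y \<in> psd_normal (G x)}"

definition stationary ::
    "(real ^ 'n \<Rightarrow> real) \<Rightarrow> (real ^ 'n \<Rightarrow> real ^ 'p ^ 'p) \<Rightarrow> real ^ 'n \<Rightarrow> bool"
  where "stationary f G x \<longleftrightarrow> G x \<in> psd_cone \<and> multipliers f G x \<noteq> {}"

definition critical_cone ::
    "(real ^ 'n \<Rightarrow> real) \<Rightarrow> (real ^ 'n \<Rightarrow> real ^ 'p ^ 'p) \<Rightarrow> real ^ 'n \<Rightarrow> (real ^ 'n) set"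
  where "critical_cone f G x =
    {d. frechet_derivative G (at x) d \<in> tangent_cone psd_cone (G x) \<and>
        frechet_derivative f (at x) d \<le> 0}"

definition SOSC ::
    "(real ^ 'n \<Rightarrow> real) \<Rightarrow> (real ^ 'n \<Rightarrow> real ^ 'p ^ 'p) \<Rightarrow> real ^ 'n \<Rightarrow> real ^ 'p ^ 'p \<Rightarrow> bool"
  where "SOSC f G x y \<longleftrightarrow>
    (\<forall>d \<in> critical_cone f G x - {0}.
      ereal (d \<bullet> hessian (\<lambda>x. lagrangian f G x y) x d)
        - support_fun y (psd_second_tangent (G x) (frechet_derivative G (at x) d)) > 0)"

text \<open>
  The library's \<open>adjoint\<close> of \<open>G'(x)\<close> is a map on all matrices; its restriction to \<open>S\<^sup>p\<close> is
  the adjoint of \<open>G'(x)\<close> as a map into \<open>S\<^sup>p\<close>.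
\<close>

definition critical_multiplier ::
    "(real ^ 'n \<Rightarrow> real) \<Rightarrow> (real ^ 'n \<Rightarrow> real ^ 'p ^ 'p) \<Rightarrow> real ^ 'n \<Rightarrow> real ^ 'p ^ 'p \<Rightarrow> bool"
  where "critical_multiplier f G x y \<longleftrightarrow> y \<in> multipliers f G x \<and>
    (\<exists>\<xi>. \<xi> \<noteq> 0 \<and>
      0 \<in> (\<lambda>k. hessian (\<lambda>x. lagrangian f G x y) x \<xi> + adjoint (frechet_derivative G (at x)) k)
            ` graphical_derivative psd_normal (G x) y (frechet_derivative G (at x) \<xi>))"

definition noncritical_multiplier ::
    "(real ^ 'n \<Rightarrow> real) \<Rightarrow> (real ^ 'n \<Rightarrow> real ^ 'p ^ 'p) \<Rightarrow> real ^ 'n \<Rightarrow> real ^ 'p ^ 'p \<Rightarrow> bool"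
  where "noncritical_multiplier f G x y \<longleftrightarrow>
    y \<in> multipliers f G x \<and> \<not> critical_multiplier f G x y"

end

theory Submission imports Defs begin

text \<open>
  Let \<open>A = G(xbar)\<close>, \<open>y = ybar\<close>, and suppose that \<open>\<xi> \<noteq> 0\<close>, \<open>H = G'(xbar) \<xi>\<close> and \<open>k \<in> DN(A, y)(H)\<close>
  witness criticality. Pairing the criticality equation with \<open>\<xi>\<close> gives
  \<open>\<langle>\<xi>, \<nabla>\<^sup>2L \<xi>\<rangle> = - \<langle>k, H\<rangle>\<close>. Points \<open>(X, Y)\<close> of the graph of the normal cone map satisfy \<open>X Y = 0\<close>;
  expanding this along a sequence defining the tangent vector \<open>(H, k)\<close> yields
  \<open>\<langle>y, H\<rangle> = 0\<close>, so that \<open>\<xi>\<close> is a critical direction, and \<open>- \<langle>k, H\<rangle> = 2 \<langle>y, H B H\<rangle>\<close> for any symmetric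
  generalized inverse \<open>B\<close> of \<open>A\<close> commuting with \<open>A\<close>. An explicit second order tangent \<open>W\<close> has
  \<open>\<langle>y, W\<rangle> = 2 \<langle>y, H B H\<rangle>\<close>, which contradicts the second order condition. The value of the support
  function is not needed, only this lower bound.
\<close>

section \<open>Matrix products, transposes and the trace inner product\<close>

lemma bounded_bilinear_matrix_mult:
  "bounded_bilinear ((**) :: real ^ 'n ^ 'm \<Rightarrow> real ^ 'k ^ 'n \<Rightarrow> real ^ 'k ^ 'm)"
proof -
  have "bilinear ((**) :: real ^ 'n ^ 'm \<Rightarrow> real ^ 'k ^ 'n \<Rightarrow> real ^ 'k ^ 'm)"
    by (auto simp: bilinear_def linear_iff matrix_matrix_mult_def vec_eq_iff sum.distrib
        algebra_simps sum_distrib_left)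
  then show ?thesis
    by (simp add: bilinear_conv_bounded_bilinear)
qed

lemmas matrix_mult_simps =
  bounded_bilinear.add_left[OF bounded_bilinear_matrix_mult]
  bounded_bilinear.add_right[OF bounded_bilinear_matrix_mult]
  bounded_bilinear.diff_left[OF bounded_bilinear_matrix_mult]
  bounded_bilinear.diff_right[OF bounded_bilinear_matrix_mult]
  bounded_bilinear.minus_left[OF bounded_bilinear_matrix_mult]
  bounded_bilinear.minus_right[OF bounded_bilinear_matrix_mult]
  bounded_bilinear.scaleR_left[OF bounded_bilinear_matrix_mult]
  bounded_bilinear.scaleR_right[OF bounded_bilinear_matrix_mult]
  bounded_bilinear.zero_left[OF bounded_bilinear_matrix_mult]
  bounded_bilinear.zero_right[OF bounded_bilinear_matrix_mult]

lemmas tendsto_matrix_mult = bounded_bilinear.tendsto[OF bounded_bilinear_matrix_mult]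

lemma linear_transpose: "linear (transpose :: real ^ 'n ^ 'm \<Rightarrow> real ^ 'm ^ 'n)"
  by (simp add: linear_iff transpose_def vec_eq_iff)

lemmas transpose_simps =
  linear_add[OF linear_transpose] linear_diff[OF linear_transpose] transpose_scalar
  matrix_transpose_mul

lemmas tendsto_transpose =
  bounded_linear.tendsto[OF linear_transpose[unfolded linear_conv_bounded_linear]]

lemma inner_transpose:
  fixes A B :: "real ^ 'n ^ 'm"
  shows "transpose A \<bullet> transpose B = A \<bullet> B"
  unfolding inner_vec_def transpose_def by (simp add: sum.swap[of _ "UNIV::'n set"])

text \<open>This rule and its right-hand counterpart do the work of the cyclicity of the trace for
  the entrywise inner product.\<close>

lemma inner_matrix_mult_left:
  fixes M :: "real ^ 'n ^ 'm" and N :: "real ^ 'k ^ 'n" and Y :: "real ^ 'k ^ 'm"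
  shows "Y \<bullet> (M ** N) = (transpose M ** Y) \<bullet> N"
proof -
  have "Y \<bullet> (M ** N) = (\<Sum>i\<in>UNIV. \<Sum>j\<in>UNIV. \<Sum>l\<in>UNIV. M $ i $ l * Y $ i $ j * N $ l $ j)"
    by (simp add: inner_vec_def matrix_matrix_mult_def sum_distrib_left mult_ac)
  also have "\<dots> = (\<Sum>i\<in>UNIV. \<Sum>l\<in>UNIV. \<Sum>j\<in>UNIV. M $ i $ l * Y $ i $ j * N $ l $ j)"
    by (intro sum.cong refl sum.swap)
  also have "\<dots> = (\<Sum>l\<in>UNIV. \<Sum>i\<in>UNIV. \<Sum>j\<in>UNIV. M $ i $ l * Y $ i $ j * N $ l $ j)"
    by (rule sum.swap)
  also have "\<dots> = (\<Sum>l\<in>UNIV. \<Sum>j\<in>UNIV. \<Sum>i\<in>UNIV. M $ i $ l * Y $ i $ j * N $ l $ j)"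
    by (intro sum.cong refl sum.swap)
  also have "\<dots> = (transpose M ** Y) \<bullet> N"
    by (simp add: inner_vec_def matrix_matrix_mult_def transpose_def sum_distrib_left mult_ac)
  finally show ?thesis .
qed

lemma inner_matrix_mult_right:
  fixes M :: "real ^ 'n ^ 'm" and N :: "real ^ 'k ^ 'n" and Y :: "real ^ 'k ^ 'm"
  shows "Y \<bullet> (M ** N) = (Y ** transpose N) \<bullet> M"
  using inner_matrix_mult_left[of "transpose Y" "transpose N" "transpose M"]
  by (metis inner_transpose matrix_transpose_mul transpose_transpose)

lemma inner_matrix_vector_mult:
  fixes A :: "real ^ 'n ^ 'm"
  shows "x \<bullet> (A *v y) = (transpose A *v x) \<bullet> y"
  by (simp add: dot_lmul_matrix)

section \<open>Kernel projections and symmetric generalized inverses\<close>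

lemma symmetric_kernel_projection_exists:
  fixes A :: "real ^ 'n ^ 'm"
  obtains Q :: "real ^ 'n ^ 'n"
  where "transpose Q = Q" "A ** Q = 0" "\<And>x. A *v x = 0 \<Longrightarrow> Q *v x = x"
proof -
  have "subspace {x. A *v x = 0}"
    by (auto simp: subspace_def matrix_vector_right_distrib matrix_vector_mult_scaleR)
  then obtain S where S: "S \<subseteq> {x. A *v x = 0}" "pairwise orthogonal S"
    "\<And>x. x \<in> S \<Longrightarrow> norm x = 1" "independent S" "span S = {x. A *v x = 0}"
    by (metis orthonormal_basis_subspace)
  have fin: "finite S" using S(4) by (rule finiteI_independent)
  \<comment> \<open>The sum of the rank-one projections onto the members of an orthonormal basis of
    the kernel; \<open>Q *v v\<close> is the orthogonal expansion of the kernel part of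
    \<open>v\<close>.\<close>
  define Q :: "real ^ 'n ^ 'n" where "Q = (\<chi> i j. \<Sum>b\<in>S. b $ i * b $ j)"
  have Qv: "Q *v v = (\<Sum>b\<in>S. (b \<bullet> v) *\<^sub>R b)" for v
  proof -
    have "(\<Sum>j\<in>UNIV. (\<Sum>b\<in>S. b $ i * b $ j) * v $ j) = (\<Sum>b\<in>S. (\<Sum>j\<in>UNIV. b $ j * v $ j) * b $ i)" for i
      by (simp only: sum_distrib_right, subst sum.swap) (simp add: mult_ac)
    then show ?thesis
      by (simp add: Q_def vec_eq_iff matrix_vector_mult_def inner_vec_def)
  qed
  show thesis
  proof
    show "transpose Q = Q"
      by (simp add: Q_def transpose_def vec_eq_iff mult.commute)
    have "Q *v v \<in> span S" for v
      unfolding Qv by (intro span_sum span_scale span_base)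
    then show "A ** Q = 0"
      unfolding S(5) by (simp add: matrix_eq flip: matrix_vector_mul_assoc)
    fix x assume "A *v x = 0"
    then have "x \<in> span S" by (simp add: S(5))
    then have "x - Q *v x \<in> span S"
      unfolding Qv by (intro span_diff span_sum span_scale) (auto intro: span_base)
    moreover have "orthogonal (x - Q *v x) b" if "b \<in> S" for b
    proof -
      have "(\<Sum>c\<in>S. (c \<bullet> x) * (c \<bullet> b)) = (\<Sum>c\<in>S. if c = b then b \<bullet> x else 0)"
        using S(2,3) that
        by (intro sum.cong) (auto simp: pairwise_def orthogonal_def norm_eq_1)
      then show ?thesis
        using that fin by (simp add: orthogonal_def Qv inner_diff_left inner_sum_left)
          (simp add: inner_commute)
    qed
    ultimately have "orthogonal (x - Q *v x) (x - Q *v x)"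
      by (metis orthogonal_to_span)
    then show "Q *v x = x"
      by (simp add: orthogonal_self)
  qed
qed

text \<open>If \<open>Q\<close> is the orthogonal projection onto the kernel of \<open>A\<close>, then \<open>A + Q\<close> is invertible and
  its inverse is a generalized inverse of \<open>A\<close>.\<close>

lemma symmetric_generalized_inverse_exists:
  fixes A :: "real ^ 'n ^ 'n"
  assumes A: "transpose A = A"
  obtains B where "transpose B = B" "A ** B = B ** A" "A ** B ** A = A"
proof -
  obtain Q where Q: "transpose Q = Q" "A ** Q = 0" "\<And>x. A *v x = 0 \<Longrightarrow> Q *v x = x"
    using symmetric_kernel_projection_exists[of A] by metis
  \<comment> \<open>\<open>A ** Q = 0\<close> leaves \<open>A *v (A *v v) = 0\<close>, so
    \<open>A *v v\<close> has norm zero by symmetry; then \<open>v\<close> lies in the kernel and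
    equals \<open>Q *v v\<close>, which is now zero.\<close>
  have "v = 0" if v: "(A + Q) *v v = 0" for v
  proof -
    have "A *v ((A + Q) *v v) = 0" using v by simp
    then have "A *v (A *v v) = 0"
      by (simp add: matrix_vector_mul_assoc matrix_mult_simps Q(2))
    then have "(A *v v) \<bullet> (A *v v) = 0"
      using inner_matrix_vector_mult[of "A *v v" A v] A by simp
    then have "A *v v = 0" by simp
    then show "v = 0"
      using v Q(3) by (simp add: matrix_vector_mult_add_rdistrib)
  qed
  then obtain B where B: "B ** (A + Q) = mat 1"
    using matrix_left_invertible_ker[of "A + Q"] by auto
  then have B': "(A + Q) ** B = mat 1"
    by (simp add: matrix_left_right_inverse)
  have AQ: "Q ** A = 0"
    using arg_cong[OF Q(2), of transpose] A Q(1)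
    by (simp add: matrix_transpose_mul linear_0[OF linear_transpose])
  have QQ: "Q ** Q = Q"
  proof -
    have "A *v (Q *v x) = 0" for x
      using Q(2) by (simp add: matrix_vector_mul_assoc)
    then show ?thesis
      by (simp add: matrix_eq Q(3) flip: matrix_vector_mul_assoc)
  qed
  have "B ** Q = B ** ((A + Q) ** Q)" by (simp add: matrix_mult_simps Q(2) QQ)
  then have BQ: "B ** Q = Q" by (simp add: matrix_mul_assoc B)
  have "Q ** B = (Q ** (A + Q)) ** B" by (simp add: matrix_mult_simps AQ QQ)
  then have QB: "Q ** B = Q" by (simp add: B' flip: matrix_mul_assoc)
  have BA: "B ** A = mat 1 - Q" using B BQ by (simp add: matrix_mult_simps algebra_simps)
  have AB: "A ** B = mat 1 - Q" using B' QB by (simp add: matrix_mult_simps algebra_simps)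
  have "transpose B ** (A + Q) = mat 1"
    using arg_cong[OF B', of transpose] A Q(1) by (simp add: transpose_simps)
  then have "transpose B = B"
    by (metis B' matrix_mul_assoc matrix_mul_lid matrix_mul_rid)
  moreover have "A ** B ** A = A"
    by (simp add: AB matrix_mult_simps AQ)
  ultimately show thesis using that AB BA by simp
qed

section \<open>The positive semidefinite cone and its normals\<close>

lemma psd_cone_congruence:
  fixes A M :: "real ^ 'p ^ 'p"
  assumes "A \<in> psd_cone"
  shows "transpose M ** A ** M \<in> psd_cone"
proof -
  have "v \<bullet> (transpose M ** A ** M *v v) = (M *v v) \<bullet> (A *v (M *v v))" for v
    using inner_matrix_vector_mult[of v "transpose M" "A *v (M *v v)"]
    by (simp add: matrix_vector_mul_assoc matrix_mul_assoc)
  then show ?thesis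
    using assms by (simp add: psd_cone_def sym_mats_def transpose_simps matrix_mul_assoc)
qed

lemma psd_cone_add:
  fixes A B :: "real ^ 'p ^ 'p"
  assumes "A \<in> psd_cone" "B \<in> psd_cone"
  shows "A + B \<in> psd_cone"
  using assms by (simp add: psd_cone_def sym_mats_def transpose_simps matrix_vector_mult_add_rdistrib
      inner_add_right)

lemma psd_cone_scaleR:
  fixes A :: "real ^ 'p ^ 'p"
  assumes "A \<in> psd_cone" "0 \<le> c"
  shows "c *\<^sub>R A \<in> psd_cone"
  using assms by (simp add: psd_cone_def sym_mats_def transpose_simps
     scaleR_matrix_vector_assoc[symmetric])

text \<open>For small \<open>s\<close> of the sign of \<open>a\<close> the linear term would
  dominate the quadratic one; \<open>s = a / c\<close> with a positive \<open>c\<close> above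
  \<open>b\<close> is small enough.\<close>

lemma real_linear_le_square_imp_zero:
  fixes a b :: real
  assumes "\<And>s. s * a \<le> s\<^sup>2 * b"
  shows "a = 0"
proof (rule ccontr)
  assume "a \<noteq> 0"
  define c where "c = \<bar>b\<bar> + 1"
  have "c > 0" "b < c" by (simp_all add: c_def)
  have "(a / c) * a \<le> (a / c)\<^sup>2 * b" by (rule assms)
  also have "\<dots> < (a / c)\<^sup>2 * c"
    using \<open>a \<noteq> 0\<close> \<open>c > 0\<close> \<open>b < c\<close> by (intro mult_strict_left_mono) auto
  also have "\<dots> = (a / c) * a"
    using \<open>c > 0\<close> by (simp add: power2_eq_square)
  finally show False by simp
qed

text \<open>Testing the normal vector against \<open>(1 + s M)\<^sup>T X (1 + s M)\<close> for all real \<open>s\<close> gives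
  \<open>\<langle>y, M\<^sup>T X + X M\<rangle> = 0\<close>; take \<open>M = X y\<close>.\<close>

lemma psd_normal_mult_zero:
  fixes X y :: "real ^ 'p ^ 'p"
  assumes "y \<in> psd_normal X"
  shows "X ** y = 0"
proof -
  have X: "X \<in> psd_cone" and y: "transpose y = y"
    and le: "\<And>Z. Z \<in> psd_cone \<Longrightarrow> y \<bullet> (Z - X) \<le> 0"
    using assms by (auto simp: psd_normal_def normal_cone_def sym_mats_def split: if_splits)
  have Xs: "transpose X = X" using X by (simp add: psd_cone_def sym_mats_def)
  define M where "M = X ** y"
  have "s * (2 * (M \<bullet> M)) \<le> s\<^sup>2 * (- (y \<bullet> (transpose M ** X ** M)))" for s
  proof -
    have "transpose (mat 1 + s *\<^sub>R M) ** X ** (mat 1 + s *\<^sub>R M) - X =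
        s *\<^sub>R (transpose M ** X) + s *\<^sub>R (X ** M) + s\<^sup>2 *\<^sub>R (transpose M ** X ** M)"
      by (simp add: transpose_simps matrix_mult_simps power2_eq_square algebra_simps matrix_mul_assoc)
    moreover have "y \<bullet> (X ** M) = M \<bullet> M"
      by (simp add: inner_matrix_mult_left Xs M_def)
    moreover have "y \<bullet> (transpose M ** X) = M \<bullet> M"
      using inner_transpose[of y "X ** M"] calculation(2) Xs y by (simp add: transpose_simps)
    ultimately show ?thesis
      using le[OF psd_cone_congruence[OF X, of "mat 1 + s *\<^sub>R M"]]
      by (simp add: inner_add_right)
  qed
  from real_linear_le_square_imp_zero[OF this] show ?thesis
    by (simp add: M_def)
qed

lemma psd_normalD:
  fixes X y :: "real ^ 'p ^ 'p"
  assumes "y \<in> psd_normal X"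
  shows "X \<in> psd_cone" "transpose X = X" "transpose y = y" "X ** y = 0" "y ** X = 0"
proof -
  show X: "X \<in> psd_cone" "transpose X = X" and y: "transpose y = y"
    using assms
    by (auto simp: psd_normal_def normal_cone_def psd_cone_def sym_mats_def split: if_splits)
  show Xy: "X ** y = 0" by (rule psd_normal_mult_zero[OF assms])
  show "y ** X = 0"
    using arg_cong[OF Xy, of transpose] X y
    by (simp add: matrix_transpose_mul linear_0[OF linear_transpose])
qed

section \<open>The graphical derivative of the normal cone map and second order tangents\<close>

lemma graphical_derivative_psd_normal_tangent:
  assumes "k \<in> graphical_derivative psd_normal A y H"
  shows "H \<in> tangent_cone psd_cone A"
proof -
  obtain t :: "nat \<Rightarrow> real" and u where t: "filterlim t (at_right 0) sequentially"
    and u: "u \<longlonglongrightarrow> (H, k)"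
    and gr: "\<And>n. u n \<in> (\<lambda>w. (w - (A, y)) /\<^sub>R t n) ` graph_of psd_normal"
    using assms unfolding graphical_derivative_def tangent_cone_def outer_limit_def by blast
  have "(\<lambda>n. fst (u n)) \<longlonglongrightarrow> H"
    using tendsto_fst[OF u] by simp
  \<comment> \<open>Graph points have their first component in the cone, because
    \<open>normal_cone\<close> is empty elsewhere.\<close>
  moreover have "fst (u n) \<in> (\<lambda>w. (w - A) /\<^sub>R t n) ` psd_cone" for n
    using gr[of n] by (auto simp: graph_of_def psd_normal_def normal_cone_def split: if_splits)
  ultimately show ?thesis
    unfolding tangent_cone_def outer_limit_def using t
    by (intro CollectI exI[of _ t] exI[of _ "\<lambda>n. fst (u n)"]) auto
qed

text \<open>The matrix equations come from expanding \<open>(A + t H\<^sub>t) (y + t k\<^sub>t) = 0\<close> in powers of \<open>t\<close>; in the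
  last one the factors \<open>M\<close> and \<open>N\<close> kill everything except the second order term.\<close>

lemma graphical_derivative_psd_normal:
  fixes A y H k :: "real ^ 'p ^ 'p"
  assumes y: "y \<in> psd_normal A"
    and k: "k \<in> graphical_derivative psd_normal A y H"
  shows "transpose H = H" "transpose k = k" "H ** y + A ** k = 0"
    "\<And>(M :: real ^ 'p ^ 'p) (N :: real ^ 'p ^ 'p). \<lbrakk>M ** A = 0; y ** N = 0\<rbrakk> \<Longrightarrow> M ** H ** k ** N = 0"
    "\<And>v. A *v v = 0 \<Longrightarrow> 0 \<le> v \<bullet> (H *v v)"
proof -
  obtain t :: "nat \<Rightarrow> real" and u where t: "filterlim t (at_right 0) sequentially"
    and u: "u \<longlonglongrightarrow> (H, k)"
    and gr: "\<And>n. u n \<in> (\<lambda>w. (w - (A, y)) /\<^sub>R t n) ` graph_of psd_normal"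
    using k unfolding graphical_derivative_def tangent_cone_def outer_limit_def by blast
  define h l where "h n = fst (u n)" and "l n = snd (u n)" for n
  have h: "h \<longlonglongrightarrow> H" and l: "l \<longlonglongrightarrow> k"
    using tendsto_fst[OF u] tendsto_snd[OF u] by (simp_all add: h_def[abs_def] l_def[abs_def])
  have t0: "t \<longlonglongrightarrow> 0" and tpos: "\<forall>\<^sub>F n in sequentially. 0 < t n"
    using t by (auto simp: filterlim_at elim: eventually_mono)
  have Ay: "A ** y = 0" and A: "transpose A = A" and ys: "transpose y = y"
    using psd_normalD[OF y] by simp_all
  \<comment> \<open>Undoing the difference quotient needs a nonzero \<open>t n\<close>, and
    positivity is guaranteed only eventually.\<close>
  have ev: "\<forall>\<^sub>F n in sequentially. 0 < t n \<and> y + t n *\<^sub>R l n \<in> psd_normal (A + t n *\<^sub>R h n)"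
    using tpos
  proof eventually_elim
    case (elim n)
    obtain X Y where "Y \<in> psd_normal X" "u n = ((X, Y) - (A, y)) /\<^sub>R t n"
      using gr[of n] by (auto simp: graph_of_def)
    moreover from this elim have "X = A + t n *\<^sub>R h n" "Y = y + t n *\<^sub>R l n"
      by (simp_all add: h_def l_def)
    ultimately show ?case using elim by simp
  qed
  have lim_zero: "a = 0" if "f \<longlonglongrightarrow> a" "\<forall>\<^sub>F n in sequentially. f n = 0"
    for f :: "nat \<Rightarrow> real ^ 'p ^ 'p" and a
    using that by (metis LIMSEQ_unique tendsto_eventually)
  have "\<forall>\<^sub>F n in sequentially. transpose (h n) - h n = 0"
    using ev
  proof eventually_elim
    case (elim n)
    then have "transpose (A + t n *\<^sub>R h n) = A + t n *\<^sub>R h n"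
      using psd_normalD(2) by blast
    then show ?case using elim A by (simp add: transpose_simps)
  qed
  from lim_zero[OF tendsto_diff[OF tendsto_transpose[OF h] h] this]
  show "transpose H = H" by simp
  have "\<forall>\<^sub>F n in sequentially. transpose (l n) - l n = 0"
    using ev
  proof eventually_elim
    case (elim n)
    then have "transpose (y + t n *\<^sub>R l n) = y + t n *\<^sub>R l n"
      using psd_normalD(3) by blast
    then show ?case using elim ys by (simp add: transpose_simps)
  qed
  from lim_zero[OF tendsto_diff[OF tendsto_transpose[OF l] l] this]
  show "transpose k = k" by simp
  have eq: "\<forall>\<^sub>F n in sequentially. h n ** y + A ** l n + t n *\<^sub>R (h n ** l n) = 0"
    using ev
  proof eventually_elim
    case (elim n)
    then have "(A + t n *\<^sub>R h n) ** (y + t n *\<^sub>R l n) = 0"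
      using psd_normal_mult_zero by blast
    then have "t n *\<^sub>R (h n ** y + A ** l n + t n *\<^sub>R (h n ** l n)) = 0"
      by (simp add: matrix_mult_simps Ay algebra_simps)
    then show ?case using elim by simp
  qed
  have "(\<lambda>n. h n ** y + A ** l n + t n *\<^sub>R (h n ** l n)) \<longlonglongrightarrow> H ** y + A ** k + 0 *\<^sub>R (H ** k)"
    by (intro tendsto_intros tendsto_matrix_mult h l t0)
  from lim_zero[OF this eq] show "H ** y + A ** k = 0" by simp
  show "M ** H ** k ** N = 0" if MN: "M ** A = 0" "y ** N = 0" for M N :: "real ^ 'p ^ 'p"
  proof -
    have "\<forall>\<^sub>F n in sequentially. M ** h n ** l n ** N = 0"
      using eq tpos
    proof eventually_elim
      case (elim n)
      have "M ** (h n ** y + A ** l n + t n *\<^sub>R (h n ** l n)) ** N =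
          M ** h n ** (y ** N) + (M ** A) ** l n ** N + t n *\<^sub>R (M ** h n ** l n ** N)"
        by (simp add: matrix_mult_simps matrix_mul_assoc)
      then show ?case using elim by (simp add: MN matrix_mult_simps)
    qed
    moreover have "(\<lambda>n. M ** h n ** l n ** N) \<longlonglongrightarrow> M ** H ** k ** N"
      by (intro tendsto_const tendsto_matrix_mult h l)
    ultimately show ?thesis by (rule lim_zero[rotated])
  qed
  \<comment> \<open>On the kernel of \<open>A\<close>, semidefiniteness of
    \<open>A + t n *\<^sub>R h n\<close> is a statement about \<open>h n\<close> alone.\<close>
  show "0 \<le> v \<bullet> (H *v v)" if v: "A *v v = 0" for v
  proof (rule tendsto_lowerbound)
    show "(\<lambda>n. v \<bullet> (h n *v v)) \<longlonglongrightarrow> v \<bullet> (H *v v)"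
      unfolding matrix_vector_mult_def by (intro tendsto_intros h)
    show "\<forall>\<^sub>F n in sequentially. 0 \<le> v \<bullet> (h n *v v)"
      using ev
    proof eventually_elim
      case (elim n)
      then have "0 \<le> v \<bullet> ((A + t n *\<^sub>R h n) *v v)"
        by (auto simp: psd_normal_def normal_cone_def psd_cone_def split: if_splits)
      then show ?case
        using elim v by (simp add: matrix_vector_mult_add_rdistrib zero_le_mult_iff
            scaleR_matrix_vector_assoc[symmetric])
    qed
  qed simp
qed

text \<open>The identity on the space splits into the orthogonal projections onto the range of \<open>A\<close>, the
  range of \<open>y\<close> and their common kernel. The first two parts of \<open>\<langle>k, H\<rangle>\<close> both equal
  \<open>- \<langle>y, H B H\<rangle>\<close>; the third vanishes.\<close>

lemma graphical_derivative_psd_normal_inner: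
  fixes A y H k B :: "real ^ 'p ^ 'p"
  assumes y: "y \<in> psd_normal A"
    and k: "k \<in> graphical_derivative psd_normal A y H"
    and B: "transpose B = B" "A ** B = B ** A" "A ** B ** A = A"
  shows "k \<bullet> H = - 2 * (y \<bullet> (H ** B ** H))"
proof -
  note gd = graphical_derivative_psd_normal[OF y k]
  have Ay: "A ** y = 0" and A: "transpose A = A" and ys: "transpose y = y"
    using psd_normalD[OF y] by simp_all
  note yA = psd_normalD(5)[OF y]
  have Ak: "A ** k = - (H ** y)" using gd(3) by (simp add: eq_neg_iff_add_eq_0 add.commute)
  then have Hy: "H ** y = - (A ** k)" by simp
  have yH: "y ** H = - (k ** A)"
    using arg_cong[OF Ak, of transpose] gd(1,2) A ys
    by (simp add: transpose_simps linear_neg[OF linear_transpose])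
  obtain C where C: "transpose C = C" "y ** C = C ** y" "y ** C ** y = y"
    using symmetric_generalized_inverse_exists[OF ys] by metis
  have 1: "k \<bullet> (A ** B ** H) = - (y \<bullet> (H ** B ** H))"
  proof -
    have "k \<bullet> (A ** B ** H) = (A ** k) \<bullet> (B ** H)"
      by (simp add: inner_matrix_mult_left A flip: matrix_mul_assoc)
    also have "\<dots> = - (y \<bullet> (H ** B ** H))"
      by (simp add: Ak inner_matrix_mult_left gd(1) matrix_mult_simps flip: matrix_mul_assoc)
    finally show ?thesis .
  qed
  \<comment> \<open>Writing \<open>y = y ** C ** y\<close> isolates \<open>y ** H\<close> and
    \<open>H ** y\<close>, which become \<open>- (k ** A)\<close> and \<open>- (A ** k)\<close>;
    then \<open>A ** B ** A = A\<close> removes \<open>B\<close>.\<close>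
  have 2: "k \<bullet> (C ** y ** H) = - (y \<bullet> (H ** B ** H))"
  proof -
    have "y \<bullet> (H ** B ** H) = (y ** C ** y) \<bullet> (H ** B ** H)"
      by (simp add: C(3))
    also have "\<dots> = C \<bullet> ((y ** H) ** B ** (H ** y))"
      using inner_matrix_mult_left[of C y "H ** B ** H ** y"]
        inner_matrix_mult_right[of "y ** C" "H ** B ** H" y]
      by (simp add: ys inner_matrix_mult_left inner_matrix_mult_right matrix_mul_assoc)
    also have "(y ** H) ** B ** (H ** y) = k ** (A ** B ** A) ** k"
      unfolding yH Hy by (simp add: matrix_mult_simps matrix_mul_assoc)
    also have "C \<bullet> (k ** (A ** B ** A) ** k) = (C ** k) \<bullet> (k ** A)"
      by (simp add: B(3) inner_matrix_mult_right[of C "k ** A"] gd(2))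
    also have "\<dots> = k \<bullet> (C ** (k ** A))"
      by (simp add: inner_matrix_mult_left C(1))
    also have "\<dots> = - (k \<bullet> (C ** y ** H))"
      by (simp add: yH matrix_mult_simps flip: matrix_mul_assoc)
    finally show ?thesis by simp
  qed
  \<comment> \<open>The projection onto the common kernel: \<open>A ** B\<close> and
    \<open>C ** y\<close> project onto the ranges of \<open>A\<close> and \<open>y\<close>, which
    are orthogonal since \<open>A ** y = 0\<close>.\<close>
  define R where "R = mat 1 - A ** B - C ** y"
  have Rs: "transpose R = R"
    by (simp add: R_def transpose_simps A B(1,2) ys C(1,2))
  have RA: "R ** A = 0"
    using B(3) yA by (simp add: R_def matrix_mult_simps flip: matrix_mul_assoc)
  have yR: "y ** R = 0"
    using C(3) yA by (simp add: R_def matrix_mult_simps matrix_mul_assoc)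
  have RR: "R ** R = R"
  proof -
    have "R ** y = 0"
      using arg_cong[OF yR, of transpose] ys Rs
      by (simp add: matrix_transpose_mul linear_0[OF linear_transpose])
    moreover have "R ** R = R - R ** A ** B - R ** y ** C"
      by (subst (2) R_def) (simp add: matrix_mult_simps C(2) flip: matrix_mul_assoc)
    ultimately show ?thesis using RA by (simp add: matrix_mult_simps)
  qed
  have 3: "k \<bullet> (R ** H) = 0"
  proof -
    have "k \<bullet> (R ** H) = (R ** k) \<bullet> (R ** H)"
      using inner_matrix_mult_left[of k R "R ** H"] by (simp add: Rs RR matrix_mul_assoc)
    also have "\<dots> = R \<bullet> (R ** H ** k)"
      by (simp add: inner_matrix_mult_right[of R "R ** H"] gd(2))
    \<comment> \<open>The pairing is now the trace of \<open>R ** H ** k ** R\<close>, which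
      vanishes by the second order equation with both outer factors equal to
      \<open>R\<close>.\<close>
    also have "\<dots> = mat 1 \<bullet> (R ** H ** k ** R)"
      by (simp add: inner_matrix_mult_right[of "mat 1" "R ** H ** k"] Rs)
    finally show ?thesis by (simp add: gd(4)[OF RA yR])
  qed
  have "H = A ** B ** H + C ** y ** H + R ** H"
    by (simp add: R_def matrix_mult_simps)
  then have "k \<bullet> H = k \<bullet> (A ** B ** H) + k \<bullet> (C ** y ** H) + k \<bullet> (R ** H)"
    by (metis inner_add_right)
  then show ?thesis using 1 2 3 by simp
qed

text \<open>Multiplying the first order equation by \<open>y\<close> from the left gives
  \<open>y ** H ** y = 0\<close>, since \<open>y ** A = 0\<close>. A generalized inverse
  \<open>C\<close> of \<open>y\<close> turns the pairing with \<open>H\<close> into one of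
  \<open>C\<close> with this product.\<close>

lemma graphical_derivative_psd_normal_orthogonal:
  fixes A y H k :: "real ^ 'p ^ 'p"
  assumes y: "y \<in> psd_normal A"
    and k: "k \<in> graphical_derivative psd_normal A y H"
  shows "y \<bullet> H = 0"
proof -
  have Ay: "A ** y = 0" and A: "transpose A = A" and ys: "transpose y = y"
    using psd_normalD[OF y] by simp_all
  note yA = psd_normalD(5)[OF y]
  obtain C where C: "transpose C = C" "y ** C ** y = y"
    using symmetric_generalized_inverse_exists[OF ys] by metis
  have "y ** (H ** y + A ** k) = 0"
    by (simp add: graphical_derivative_psd_normal(3)[OF y k] matrix_mult_simps)
  then have "y ** H ** y = 0"
    by (simp add: matrix_mult_simps matrix_mul_assoc yA)
  moreover have "(y ** C ** y) \<bullet> H = C \<bullet> (y ** H ** y)"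
    by (simp add: inner_matrix_mult_left[of C y] inner_matrix_mult_right[of "y ** C" H] ys
        flip: matrix_mul_assoc)
  ultimately show ?thesis by (simp add: C(2))
qed

text \<open>Take \<open>W = 2 X\<^sup>T A X\<close>, where \<open>X\<close> solves \<open>X\<^sup>T A + A X = H - Q H Q\<close> and \<open>Q\<close> is the orthogonal
  projection onto the kernel of \<open>A\<close>, so that
  \<open>A + t H + (t\<^sup>2/2) W = (1 + t X)\<^sup>T A (1 + t X) + t Q H Q\<close> is positive semidefinite.\<close>

lemma psd_second_tangent_witness:
  fixes A y H k B :: "real ^ 'p ^ 'p"
  assumes y: "y \<in> psd_normal A"
    and k: "k \<in> graphical_derivative psd_normal A y H"
    and B: "transpose B = B" "A ** B = B ** A" "A ** B ** A = A"
  obtains W where "W \<in> psd_second_tangent A H" "y \<bullet> W = 2 * (y \<bullet> (H ** B ** H))"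
proof -
  note gd = graphical_derivative_psd_normal[OF y k]
  have Ay: "A ** y = 0" and A: "transpose A = A" and ys: "transpose y = y" and Apsd: "A \<in> psd_cone"
    using psd_normalD[OF y] by simp_all
  have Ak: "A ** k = - (H ** y)" using gd(3) by (simp add: eq_neg_iff_add_eq_0 add.commute)
  define P where "P = A ** B"
  define Q where "Q = mat 1 - P"
  have Ps: "transpose P = P" by (simp add: P_def transpose_simps A B)
  have PA: "P ** A = A" by (simp add: P_def B(3))
  have AQ: "A ** Q = 0" using B by (simp add: Q_def P_def matrix_mult_simps matrix_mul_assoc)
  have Py: "P ** y = 0" using Ay by (simp add: P_def B(2) matrix_mult_simps flip: matrix_mul_assoc)
  have Qs: "transpose Q = Q" by (simp add: Q_def transpose_simps Ps)
  \<comment> \<open>The subtracted half keeps the block \<open>P ** H ** P\<close> from being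
    counted twice in \<open>transpose X ** A + A ** X\<close>.\<close>
  define X where "X = B ** H - (1/2) *\<^sub>R (B ** H ** P)"
  have AX: "A ** X = P ** H - (1/2) *\<^sub>R (P ** H ** P)"
    by (simp add: X_def P_def matrix_mult_simps matrix_mul_assoc)
  have XA: "transpose X ** A = H ** P - (1/2) *\<^sub>R (P ** H ** P)"
    using arg_cong[OF AX, of transpose] by (simp add: transpose_simps A Ps gd(1) matrix_mul_assoc)
  have sum: "transpose X ** A + A ** X + Q ** H ** Q = H"
    unfolding AX XA by (simp add: Q_def matrix_mult_simps matrix_mul_assoc)
  have "v \<bullet> (Q ** H ** Q *v v) = (Q *v v) \<bullet> (H *v (Q *v v))" for v
    using inner_matrix_vector_mult[of v Q "H *v (Q *v v)"]
    by (simp only: matrix_vector_mul_assoc matrix_mul_assoc Qs)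
  moreover have "A *v (Q *v v) = 0" for v
    by (simp add: matrix_vector_mul_assoc AQ)
  ultimately have QHQ: "Q ** H ** Q \<in> psd_cone"
    using gd(5) by (simp add: psd_cone_def sym_mats_def transpose_simps Qs gd(1) matrix_mul_assoc)
  define W where "W = 2 *\<^sub>R (transpose X ** A ** X)"
  have "infdist (A + t *\<^sub>R H + (t\<^sup>2 / 2) *\<^sub>R W) psd_cone = 0" if "0 < t" for t
  proof -
    have "A + t *\<^sub>R H + (t\<^sup>2 / 2) *\<^sub>R W =
        A + t *\<^sub>R (transpose X ** A + A ** X + Q ** H ** Q) + t\<^sup>2 *\<^sub>R (transpose X ** A ** X)"
      by (simp add: sum W_def)
    also have "\<dots> = transpose (mat 1 + t *\<^sub>R X) ** A ** (mat 1 + t *\<^sub>R X) + t *\<^sub>R (Q ** H ** Q)"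
      by (simp add: transpose_simps matrix_mult_simps power2_eq_square algebra_simps matrix_mul_assoc)
    also have "\<dots> \<in> psd_cone"
      using that by (intro psd_cone_add psd_cone_scaleR psd_cone_congruence Apsd QHQ) simp
    finally show ?thesis by simp
  qed
  then have "\<forall>\<^sub>F t in at_right 0. infdist (A + t *\<^sub>R H + (t\<^sup>2 / 2) *\<^sub>R W) psd_cone = 0"
    by (auto simp: eventually_at_right_less intro: eventually_mono[OF eventually_at_right_less])
  then have "(\<lambda>t. infdist (A + t *\<^sub>R H + (t\<^sup>2 / 2) *\<^sub>R W) psd_cone) \<in> o[at_right 0](\<lambda>t. t\<^sup>2)"
    by (subst landau_o.small.in_cong[of _ "\<lambda>_. 0"]) simp_all
  moreover have "W \<in> sym_mats"
    by (simp add: W_def sym_mats_def transpose_simps A matrix_mul_assoc)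
  ultimately have "W \<in> psd_second_tangent A H"
    by (simp add: psd_second_tangent_def)
  moreover have "y \<bullet> (transpose X ** A ** X) = y \<bullet> (H ** B ** H)"
  proof -
    have Xy: "X ** y = B ** H ** y"
      by (simp add: X_def matrix_mult_simps Py flip: matrix_mul_assoc)
    \<comment> \<open>The range of \<open>H ** y\<close> lies in that of \<open>A\<close>, because
      \<open>H ** y = - (A ** k)\<close>; hence \<open>P\<close> fixes it.\<close>
    have PHy: "P ** (H ** y) = H ** y"
      using Ak PA by (metis matrix_mul_assoc minus_equation_iff
          bounded_bilinear.minus_right[OF bounded_bilinear_matrix_mult])
    have "y \<bullet> (transpose X ** A ** X) = (X ** y) \<bullet> (A ** X)"
      by (simp add: inner_matrix_mult_left flip: matrix_mul_assoc)
    also have "\<dots> = (A ** (X ** y)) \<bullet> X"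
      by (simp add: inner_matrix_mult_left A)
    also have "A ** (X ** y) = H ** y"
      using PHy by (simp add: Xy P_def matrix_mul_assoc)
    also have "(H ** y) \<bullet> X = H \<bullet> (X ** y)"
      by (simp add: inner_matrix_mult_right ys)
    also have "\<dots> = (H ** y) \<bullet> (B ** H)"
      by (simp add: Xy inner_matrix_mult_right[of H "B ** H" y] ys)
    also have "\<dots> = y \<bullet> (H ** B ** H)"
      by (simp add: inner_matrix_mult_left gd(1) flip: matrix_mul_assoc)
    finally show ?thesis .
  qed
  then have "y \<bullet> W = 2 * (y \<bullet> (H ** B ** H))"
    by (simp add: W_def)
  ultimately show thesis by (rule that)
qed

section \<open>First order condition and contradiction with the second order condition\<close>

theorem theorem3p4:
  fixes f :: "real ^ 'n \<Rightarrow> real"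
    and G :: "real ^ 'n \<Rightarrow> real ^ 'p ^ 'p"
    and xbar :: "real ^ 'n"
    and ybar :: "real ^ 'p ^ 'p"
  assumes "\<And>x. G x \<in> sym_mats"
    and "twice_cont_diff f"
    and "twice_cont_diff G"
    and "stationary f G xbar"
    and "ybar \<in> multipliers f G xbar"
    and "SOSC f G xbar ybar"
  shows "noncritical_multiplier f G xbar ybar"
proof -
  define A where "A = G xbar"
  define g where "g = frechet_derivative G (at xbar)"
  have y: "ybar \<in> psd_normal A" and grad: "gradient (\<lambda>x. lagrangian f G x ybar) xbar = 0"
    using assms(5) by (auto simp: multipliers_def A_def)
  have f': "(f has_derivative frechet_derivative f (at xbar)) (at xbar)"
    using assms(2) unfolding twice_cont_diff_def
    by (metis differentiable_def frechet_derivative_works)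
  have G': "(G has_derivative g) (at xbar)"
    using assms(3) unfolding twice_cont_diff_def g_def
    by (metis differentiable_def frechet_derivative_works)
  then have lin: "linear g" by (rule has_derivative_linear)
  \<comment> \<open>\<open>gradient\<close> is a definite description, so its vanishing yields
    information only once existence and uniqueness of the gradient are established.\<close>
  have first_order: "frechet_derivative f (at xbar) d + ybar \<bullet> g d = 0" for d
  proof -
    let ?L = "\<lambda>x. lagrangian f G x ybar"
    let ?D = "\<lambda>d. frechet_derivative f (at xbar) d + ybar \<bullet> g d"
    have D: "(?L has_derivative ?D) (at xbar)"
      unfolding lagrangian_def by (intro derivative_intros f' G')
    then have "linear ?D" by (rule has_derivative_linear)
    then have rep: "?D = (\<lambda>h. h \<bullet> adjoint ?D 1)"
      using adjoint_works[of ?D] by (auto simp: fun_eq_iff)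
    have ex: "GDERIV ?L xbar :> adjoint ?D 1"
      unfolding gderiv_def using D rep by metis
    have "v = w" if "GDERIV ?L xbar :> v" "GDERIV ?L xbar :> w" for v w
      using has_derivative_unique[OF that[unfolded gderiv_def]]
      by (metis inner_commute vector_eq_ldot)
    then have "gradient ?L xbar = adjoint ?D 1"
      unfolding gradient_def using ex by (intro the_equality) auto
    then show ?thesis using fun_cong[OF rep, of d] grad by simp
  qed
  have "\<not> critical_multiplier f G xbar ybar"
  proof
    assume "critical_multiplier f G xbar ybar"
    then obtain \<xi> k where \<xi>: "\<xi> \<noteq> 0"
      and k: "k \<in> graphical_derivative psd_normal A ybar (g \<xi>)"
      and zero: "hessian (\<lambda>x. lagrangian f G x ybar) xbar \<xi> + adjoint g k = 0"
      unfolding critical_multiplier_def A_def g_def by (metis (no_types, lifting) imageE)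
    obtain B where B: "transpose B = B" "A ** B = B ** A" "A ** B ** A = A"
      using symmetric_generalized_inverse_exists[OF psd_normalD(2)[OF y]] by metis
    obtain W where W: "W \<in> psd_second_tangent A (g \<xi>)" "ybar \<bullet> W = - (k \<bullet> g \<xi>)"
      using psd_second_tangent_witness[OF y k B] graphical_derivative_psd_normal_inner[OF y k B]
      by (metis minus_minus mult_minus_left)
    \<comment> \<open>Since \<open>ybar\<close> is orthogonal to \<open>g \<xi>\<close>, the first
      order condition makes the derivative of \<open>f\<close> along \<open>\<xi>\<close>
      zero.\<close>
    have "\<xi> \<in> critical_cone f G xbar"
      using first_order[of \<xi>] graphical_derivative_psd_normal_tangent[OF k]
        graphical_derivative_psd_normal_orthogonal[OF y k]
      by (simp add: critical_cone_def flip: A_def g_def)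
    then have "0 < ereal (\<xi> \<bullet> hessian (\<lambda>x. lagrangian f G x ybar) xbar \<xi>)
        - support_fun ybar (psd_second_tangent A (g \<xi>))"
      using assms(6) \<xi> by (auto simp: SOSC_def A_def g_def)
    moreover have "ereal (ybar \<bullet> W) \<le> support_fun ybar (psd_second_tangent A (g \<xi>))"
      unfolding support_fun_def by (rule SUP_upper[OF W(1)])
    moreover have "\<xi> \<bullet> hessian (\<lambda>x. lagrangian f G x ybar) xbar \<xi> = ybar \<bullet> W"
      using arg_cong[OF zero, of "\<lambda>v. \<xi> \<bullet> v"] adjoint_works[OF lin, of \<xi> k] W(2)
      by (simp add: inner_add_right inner_commute)
    \<comment> \<open>The real lower bound excludes the value minus infinity; plus infinity makes
      the difference minus infinity, and a finite value makes it nonpositive.\<close>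
    ultimately show False
      by (cases "support_fun ybar (psd_second_tangent A (g \<xi>))") auto
  qed
  then show ?thesis
    using assms(5) by (simp add: noncritical_multiplier_def)
qed

end
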